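(* Let $y$ be an even integer and $x$ an odd integer with $y/2\le x<y-1$. Let $d$ be an even integer with $0\le d\le y-x-1$. Then for every integer $c\ge0$ there is a standard linear realization of $\{1^{y-1-d},x^d,y^c\}$. Consequently, for all integers $a,b,c\ge0$ with $a\ge 2x$ and $b\ge y-x-1$, the multiset $\{1^a,x^b,y^c\}$ has a linear realization.
   Context: For a positive integer $n$, $K_n$ is the complete graph on vertex set $\{0,\dots,n-1\}$ and the linear length of an edge $\{u,w\}$ is $|u-w|$. A multiset of positive integers of size $n-1$ has a linear realization if some Hamiltonian path in $K_n$ has multiset of linear edge lengths equal to it; it is standard if the path starts at $0$. $\{x_1^{a_1},\dots\}$ denotes the multiset with $x_i$ of multiplicity $a_i$. *)

theory Defs
  imports "HOL-Library.Multiset"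
begin

definition K_verts :: "nat \<Rightarrow> nat set" where
  "K_verts n = {0..<n}"

definition K_edges :: "nat \<Rightarrow> nat set set" where
  "K_edges n = {{u, w} | u w. u \<in> K_verts n \<and> w \<in> K_verts n \<and> u \<noteq> w}"

text \<open>A path is given by the list of its vertices in the order in which they are visited.\<close>

definition hamiltonian_path :: "'v set \<Rightarrow> 'v set set \<Rightarrow> 'v list \<Rightarrow> bool" where
  "hamiltonian_path V E p \<longleftrightarrow>
     distinct p \<and> set p = V \<and> (\<forall>i. Suc i < length p \<longrightarrow> {p ! i, p ! Suc i} \<in> E)"

text \<open>The subtraction is carried out in the integers, as it is truncated on the naturals.\<close>

definition linear_length :: "nat \<Rightarrow> nat \<Rightarrow> nat" where
  "linear_length u w = nat \<bar>int u - int w\<bar>"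

definition linear_edge_lengths :: "nat list \<Rightarrow> nat multiset" where
  "linear_edge_lengths p = mset (map2 linear_length p (tl p))"

text \<open>
  A multiset of size \<open>n - 1\<close> is realized in \<open>K\<^sub>n\<close>, so the number of vertices is \<open>size M + 1\<close>.
  The elements of a realized multiset are automatically positive, since a path has no loops.
\<close>

definition linear_realization :: "nat multiset \<Rightarrow> nat list \<Rightarrow> bool" where
  "linear_realization M p \<longleftrightarrow>
     hamiltonian_path (K_verts (size M + 1)) (K_edges (size M + 1)) p \<and> linear_edge_lengths p = M"

definition standard_linear_realization :: "nat multiset \<Rightarrow> nat list \<Rightarrow> bool" where
  "standard_linear_realization M p \<longleftrightarrow> linear_realization M p \<and> hd p = 0"

end

theory Submission
  imports Defs
begin

text \<open>
  If a standard path on \<open>{..<n}\<close> uses the edge \<open>{u, u + 1}\<close> with \<open>u = n - m\<close>, then replacing it by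
  \<open>u, u + m, u + m + 1, u + 1\<close> gives a standard path on \<open>{..<n + 2}\<close> with two more edges of length
  \<open>m\<close>, and \<open>{u + m, u + m + 1}\<close> is again an edge. If the last \<open>m\<close> vertices are matched by such edges,
  this can be repeated forever. For \<open>m = y\<close> it reduces the first claim to \<open>c = 0\<close> and \<open>c = 1\<close>, where
  explicit paths zigzag between \<open>[0, y - x)\<close> and \<open>[x, y)\<close>.

  For the second claim take \<open>d = y - x - 1\<close>, which uses exactly \<open>x\<close> ones, and glue that path at its
  vertex \<open>0\<close> to the mirror image of a standard path for \<open>{1^(a - x), x^(b - d)}\<close>. It suffices to have
  standard paths for \<open>{1^x, x^b}\<close>, all \<open>b\<close>. These are also grown from explicit ones, now with \<open>m = x\<close>
  odd, so that one vertex or three vertices of the last \<open>x\<close> are left over by the matching: either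
  the path ends at the single one, or the three are consecutive on the path.
\<close>

section \<open>Edge lengths of vertex lists, and realizations as lists\<close>

abbreviation lengths :: "nat list \<Rightarrow> nat multiset" where
  "lengths \<equiv> linear_edge_lengths"

lemma linear_length_simps [simp]:
  "linear_length a (a + m) = m" "linear_length (a + m) a = m"
  "linear_length a (Suc a) = 1" "linear_length (Suc a) a = 1"
  "linear_length 0 m = m"
  by (auto simp: linear_length_def)

lemma linear_length_commute: "linear_length a b = linear_length b a"
  by (auto simp: linear_length_def)

lemma lengths_simps [simp]:
  "lengths [] = {#}" "lengths [a] = {#}"
  "lengths (a # b # xs) = add_mset (linear_length a b) (lengths (b # xs))"
  by (auto simp: linear_edge_lengths_def)

text \<open>The pivot \<open>a\<close> belongs to both pieces, so no edge is lost at the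
  cut.\<close>

lemma lengths_split: "lengths (xs @ a # ys) = lengths (xs @ [a]) + lengths (a # ys)"
proof (induction xs)
  case (Cons b xs)
  then show ?case by (cases xs) auto
qed simp

lemma lengths_split2: "lengths (xs @ a # b # ys) = lengths (xs @ [a]) + add_mset (linear_length a b) (lengths (b # ys))"
  by (subst lengths_split) simp

lemma lengths_append:
  assumes "xs \<noteq> []" "ys \<noteq> []"
  shows "lengths (xs @ ys) = lengths xs + add_mset (linear_length (last xs) (hd ys)) (lengths ys)"
proof -
  obtain zs a where "xs = zs @ [a]" using assms(1) by (cases xs rule: rev_cases) auto
  moreover obtain b ws where "ys = b # ws" using assms(2) by (cases ys) auto
  ultimately show ?thesis by (simp add: lengths_split2)
qed

lemma lengths_rev: "lengths (rev p) = lengths p"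
proof (induction p)
  case (Cons a p)
  then show ?case
    by (cases p) (auto simp: lengths_split2 linear_length_commute)
qed simp

lemma lengths_map:
  assumes "\<And>a b. a \<in> set p \<Longrightarrow> b \<in> set p \<Longrightarrow> linear_length (f a) (f b) = linear_length a b"
  shows "lengths (map f p) = lengths p"
  using assms
proof (induction p)
  case (Cons a p)
  then show ?case by (cases p) auto
qed simp

lemma lengths_upt: "lengths [i..<j] = replicate_mset (j - i - 1) 1"
proof (induction j)
  case (Suc j)
  show ?case
  proof (cases "i < j")
    case True
    then have "lengths [i..<Suc j] = lengths [i..<j] + {#1#}"
      by (simp add: lengths_append) (simp add: linear_length_def)
    moreover have "Suc j - i - 1 = Suc (j - i - 1)" using True by simp
    ultimately show ?thesis using Suc by simp
  next
    case False
    then show ?thesis by (cases "i = j") auto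
  qed
qed simp

lemma replicate_mset_add:
  "replicate_mset (m + n) a = replicate_mset m a + replicate_mset n a"
  by (induction m) auto

lemma size_lengths: "size (lengths p) = length p - 1"
  by (simp add: linear_edge_lengths_def)

text \<open>In a complete graph adjacency of consecutive vertices is just distinctness, and
  \<open>size M + 1\<close> is the length of the list. Non-emptiness must be demanded, since the
  empty list has the same lengths as a single vertex.\<close>

lemma linear_realization_iff:
  "linear_realization M p \<longleftrightarrow> p \<noteq> [] \<and> distinct p \<and> set p = {..<length p} \<and> lengths p = M"
proof (cases "lengths p = M \<and> distinct p")
  case True
  then have M: "size M = length p - 1" using size_lengths by blast
  have "hamiltonian_path (K_verts (size M + 1)) (K_edges (size M + 1)) p \<longleftrightarrow>
      p \<noteq> [] \<and> set p = {..<length p}"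
  proof (cases "p = []")
    case True
    then show ?thesis by (auto simp: hamiltonian_path_def K_verts_def)
  next
    case False
    then have n: "size M + 1 = length p" using M by (cases p) auto
    have "{p ! i, p ! Suc i} \<in> K_edges (length p)"
      if "set p = {..<length p}" "Suc i < length p" for i
    proof -
      have "p ! i \<in> {..<length p}" "p ! Suc i \<in> {..<length p}"
        using that nth_mem[of i p] nth_mem[of "Suc i" p] by auto
      moreover have "p ! i \<noteq> p ! Suc i"
        using True that by (simp add: nth_eq_iff_index_eq)
      ultimately show ?thesis unfolding K_edges_def K_verts_def by auto
    qed
    then show ?thesis using False True
      unfolding n hamiltonian_path_def by (auto simp: K_verts_def lessThan_atLeast0)
  qed
  then show ?thesis using True by (auto simp: linear_realization_def)
next
  case False
  then show ?thesis by (auto simp: linear_realization_def hamiltonian_path_def)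
qed

lemma standard_iff:
  "standard_linear_realization M p \<longleftrightarrow>
     p \<noteq> [] \<and> distinct p \<and> set p = {..<length p} \<and> lengths p = M \<and> hd p = 0"
  by (auto simp: standard_linear_realization_def linear_realization_iff)

lemma standard_length:
  "standard_linear_realization M p \<Longrightarrow> length p = Suc (size M)"
  using size_lengths[of p] by (cases p) (auto simp: standard_iff)

lemma standardI:
  assumes "p \<noteq> []" "distinct p" "set p = {..<n}" "hd p = 0" "lengths p = M"
  shows "standard_linear_realization M p"
proof -
  have "length p = n" using distinct_card[OF assms(2)] assms(3) by simp
  then show ?thesis using assms by (simp add: standard_iff)
qed

section \<open>The edges of a path as unordered pairs\<close>

text \<open>Unordered pairs leave open in which direction the path traverses an edge; this direction
  changes with the constructions and never matters for growing.\<close>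

definition links :: "nat list \<Rightarrow> nat set set" where
  "links p = set (map2 (\<lambda>u v. {u, v}) p (tl p))"

lemma links_simps [simp]:
  "links [] = {}" "links [a] = {}"
  "links (a # b # xs) = insert {a, b} (links (b # xs))"
  by (auto simp: links_def)

lemma links_split: "links (xs @ a # ys) = links (xs @ [a]) \<union> links (a # ys)"
proof (induction xs)
  case (Cons b xs)
  then show ?case by (cases xs) auto
qed simp

lemma links_split2: "links (xs @ a # b # ys) = links (xs @ [a]) \<union> insert {a, b} (links (b # ys))"
  by (subst links_split) simp

lemma links_append_subset: "links xs \<union> links ys \<subseteq> links (xs @ ys)"
proof (cases "xs = [] \<or> ys = []")
  case False
  then obtain zs a b ws where "xs = zs @ [a]" "ys = b # ws"
    by (metis rev_exhaust list.exhaust)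
  then show ?thesis by (auto simp: links_split2)
qed auto

lemma links_join: "xs \<noteq> [] \<Longrightarrow> ys \<noteq> [] \<Longrightarrow> {last xs, hd ys} \<in> links (xs @ ys)"
  by (cases xs rule: rev_cases; cases ys) (auto simp: links_split2)

lemma links_map: "links (map f p) = (`) f ` links p"
proof (induction p)
  case (Cons a p)
  then show ?case by (cases p) auto
qed simp

lemma links_rev: "links (rev p) = links p"
proof (induction p)
  case (Cons a p)
  then show ?case by (cases p) (auto simp: links_split2)
qed simp

lemma links_upt:
  assumes "i \<le> a" "Suc a < j"
  shows "{a, Suc a} \<in> links [i..<j]"
proof -
  have "[i..<j] = [i..<a] @ a # Suc a # [Suc (Suc a)..<j]"
    using assms upt_add_eq_append[of i a "j - a"] by (simp add: upt_conv_Cons)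
  then show ?thesis by (simp add: links_split2)
qed

lemma links_subset: "e \<in> links p \<Longrightarrow> e \<subseteq> set p"
proof (induction p)
  case (Cons a p)
  then show ?case by (cases p) auto
qed simp

lemma linksE:
  assumes "e \<in> links p"
  obtains xs a b ys where "p = xs @ a # b # ys" "e = {a, b}"
  using assms
proof (induction p arbitrary: thesis)
  case (Cons c p)
  show ?case
  proof (cases "e \<in> links p")
    case True
    then obtain xs a b ys where "p = xs @ a # b # ys" "e = {a, b}" using Cons.IH by blast
    then show ?thesis using Cons.prems(1)[of "c # xs"] by simp
  next
    case False
    then obtain d q where "p = d # q" "e = {c, d}" using Cons.prems by (cases p) auto
    then show ?thesis using Cons.prems(1)[of "[]"] by simp
  qed
qed simp

lemma links_last:
  assumes "{t, w} \<in> links (xs @ [t])" "t \<notin> set xs"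
  shows "\<exists>zs. xs = zs @ [w]"
proof (cases xs rule: rev_cases)
  case (snoc zs v)
  have "{t, w} \<notin> links (zs @ [v])"
    using links_subset[of "{t, w}" "zs @ [v]"] assms(2) snoc by auto
  then have "{t, w} = {v, t}" using assms(1) snoc by (simp add: links_split2)
  then show ?thesis using snoc by (auto simp: doubleton_eq_iff)
qed (use assms in simp)

text \<open>The vertex \<open>t\<close> occurs only once, so two different links at \<open>t\<close>
  must be the one entering it and the one leaving it. Which of \<open>u\<close> and \<open>w\<close>
  comes first remains open.\<close>

lemma two_linksE:
  assumes "distinct p" "{u, t} \<in> links p" "{t, w} \<in> links p" "u \<noteq> w"
  obtains xs a b ys where "p = xs @ a # t # b # ys" "{a, b} = {u, w}"
proof -
  have *: "\<exists>xs ys. q = xs @ w # t # u # ys"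
    if q: "distinct q" "q = xs @ t # u # ys" "{t, w} \<in> links q" for q xs ys
  proof -
    have "{t, w} \<notin> links (u # ys)"
      using links_subset[of "{t, w}" "u # ys"] q by auto
    then have "{t, w} \<in> links (xs @ [t])"
      using q \<open>u \<noteq> w\<close> by (auto simp: links_split2 doubleton_eq_iff)
    then obtain zs where "xs = zs @ [w]" using q links_last by fastforce
    then show ?thesis using q by auto
  qed
  obtain xs a b ys where p: "p = xs @ a # b # ys" "{u, t} = {a, b}"
    using assms(2) by (rule linksE)
  show ?thesis
  proof (cases "a = t \<and> b = u")
    case True
    then obtain xs' ys' where "p = xs' @ w # t # u # ys'" using *[of p xs ys] assms p by auto
    then show ?thesis using that by blast
  next
    case False
    \<comment> \<open>Otherwise the path runs from \<open>u\<close> to \<open>t\<close>, and its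
      reversal is covered by the fact just proved.\<close>
    then have "rev p = rev ys @ t # u # rev xs" using p by (auto simp: doubleton_eq_iff)
    then obtain xs' ys' where "rev p = xs' @ w # t # u # ys'"
      using *[of "rev p" "rev ys" "rev xs"] assms unfolding links_rev distinct_rev by blast
    then have "p = rev ys' @ u # t # w # rev xs'"
      by (metis append.assoc append_Cons append_Nil rev.simps(2) rev_append rev_rev_ident)
    then show ?thesis using that by blast
  qed
qed

section \<open>Lengthening paths by edges of length \<open>m\<close>\<close>

text \<open>The detour is inserted between two consecutive vertices, so the endpoint stays and only
  the link \<open>{u, Suc u}\<close> is lost. Recording this allows the step to be iterated.\<close>

lemma grow_pair:
  assumes std: "standard_linear_realization M p"
    and link: "{u, Suc u} \<in> links p" and n: "u + m = Suc (size M)"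
  obtains p' where "standard_linear_realization (M + {#m, m#}) p'"
    "{u + m, Suc (u + m)} \<in> links p'" "last p' = last p" "links p - {{u, Suc u}} \<subseteq> links p'"
proof -
  obtain xs a b ys where p: "p = xs @ a # b # ys" and ab: "{u, Suc u} = {a, b}"
    using link by (rule linksE)
  have len: "length p = u + m" using standard_length[OF std] n by simp
  have ab': "a = u \<and> b = Suc u \<or> a = Suc u \<and> b = u" using ab by (metis doubleton_eq_iff)
  have abm: "{u + m, Suc (u + m)} = {a + m, b + m}" using ab' by auto
  define p' where "p' = xs @ a # (a + m) # (b + m) # b # ys"
  have S: "distinct p" "set p = {..<u + m}" "lengths p = M" "hd p = 0"
    using std len by (auto simp: standard_iff)
  have "set p' = set p \<union> {a + m, b + m}" by (auto simp: p'_def p)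
  also have "\<dots> = {..<u + m} \<union> {u + m, Suc (u + m)}" using S(2) abm by simp
  also have "\<dots> = {..<length p'}" using len by (auto simp: p'_def p)
  finally have set: "set p' = {..<length p'}" .
  have ge: "a + m \<notin> set p" "b + m \<notin> set p" "a \<noteq> b" using ab' unfolding S(2) by (elim disjE; simp)+
  then have d: "distinct p'" using S(1) unfolding p'_def p by auto
  have "linear_length a b = 1" using ab' by auto
  moreover have "linear_length (a + m) (b + m) = linear_length a b"
    by (simp add: linear_length_def)
  ultimately have "lengths p' = lengths p + {#m, m#}" by (simp add: p'_def p lengths_split2)
  moreover have "hd p' = hd p" "last p' = last p" by (cases xs; simp add: p'_def p)+
  moreover have "{u + m, Suc (u + m)} \<in> links p'" unfolding abm by (simp add: p'_def links_split2)
  moreover have "links p - {{u, Suc u}} \<subseteq> links p'"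
    unfolding ab by (auto simp: p'_def p links_split2)
  ultimately show ?thesis using that[of p'] d set S by (auto simp: standard_iff p'_def)
qed

text \<open>Lifting the pairs from the bottom up keeps \<open>grow_pair\<close> applicable: each
  step adds two vertices, and the next pair lies two higher. By \<open>2 * k \<le> m\<close> the new
  pairs lie above all those still to be lifted.\<close>

lemma grow_pairs:
  assumes std: "standard_linear_realization M p" and n: "u + m = Suc (size M)"
    and "2 * k \<le> m" and "\<And>j. j < k \<Longrightarrow> {u + 2 * j, Suc (u + 2 * j)} \<in> links p"
  shows "\<exists>p'. standard_linear_realization (M + replicate_mset (2 * k) m) p' \<and>
    (\<forall>j<k. {u + m + 2 * j, Suc (u + m + 2 * j)} \<in> links p') \<and> last p' = last p \<and>
    (\<forall>e\<in>links p. e \<inter> {u..<u + 2 * k} = {} \<longrightarrow> e \<in> links p')"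
  using assms(3,4)
proof (induction k)
  case 0
  then show ?case using std by auto
next
  case (Suc k)
  then obtain q where q: "standard_linear_realization (M + replicate_mset (2 * k) m) q"
    "\<forall>j<k. {u + m + 2 * j, Suc (u + m + 2 * j)} \<in> links q" "last q = last p"
    "\<forall>e\<in>links p. e \<inter> {u..<u + 2 * k} = {} \<longrightarrow> e \<in> links q"
    by auto
  have "{u + 2 * k, Suc (u + 2 * k)} \<in> links q" using q(4) Suc.prems(2)[of k] by auto
  then obtain p' where p': "standard_linear_realization (M + replicate_mset (2 * k) m + {#m, m#}) p'"
    "{u + 2 * k + m, Suc (u + 2 * k + m)} \<in> links p'" "last p' = last q"
    "links q - {{u + 2 * k, Suc (u + 2 * k)}} \<subseteq> links p'"
    using grow_pair[OF q(1), of "u + 2 * k" m] n by auto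
  have "\<forall>j<Suc k. {u + m + 2 * j, Suc (u + m + 2 * j)} \<in> links p'"
  proof (intro allI impI)
    fix j assume "j < Suc k"
    show "{u + m + 2 * j, Suc (u + m + 2 * j)} \<in> links p'"
    proof (cases "j = k")
      case True
      then show ?thesis using p'(2) by (simp add: ac_simps)
    next
      case False
      then have "{u + m + 2 * j, Suc (u + m + 2 * j)} \<in> links q" using q(2) \<open>j < Suc k\<close> by auto
      moreover have "{u + m + 2 * j, Suc (u + m + 2 * j)} \<noteq> {u + 2 * k, Suc (u + 2 * k)}"
        using Suc.prems(1) by (auto simp: doubleton_eq_iff)
      ultimately show ?thesis using p'(4) by blast
    qed
  qed
  moreover have "e \<in> links p'" if "e \<in> links p" "e \<inter> {u..<u + 2 * Suc k} = {}" for e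
  proof -
    have "e \<inter> {u..<u + 2 * k} = {}" "u + 2 * k \<notin> e" using that by auto
    then show ?thesis using q(4) p'(4) that by auto
  qed
  ultimately show ?case using p'(1,3) q(3) by (intro exI[of _ p']) auto
qed

text \<open>The second premise makes \<open>last p + m\<close> the first integer not on the
  path.\<close>

lemma grow_last:
  assumes std: "standard_linear_realization M p" and n: "last p + m = Suc (size M)"
  shows "standard_linear_realization (add_mset m M) (p @ [last p + m])"
proof -
  have len: "last p + m = length p" using standard_length[OF std] n by simp
  have S: "p \<noteq> []" "distinct p" "set p = {..<length p}" "lengths p = M" "hd p = 0"
    using std by (simp_all add: standard_iff)
  have "length p \<notin> set p" by (subst S(3)) simp
  moreover have "linear_length (last p) (length p) = m" unfolding len[symmetric] by simp
  then have "lengths (p @ [length p]) = add_mset m M" using S(1,4) by (simp add: lengths_append)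
  moreover have "set (p @ [length p]) = {..<Suc (length p)}"
    unfolding set_append by (subst S(3)) auto
  ultimately show ?thesis unfolding len using S(1,2,5) by (intro standardI) simp_all
qed

text \<open>The end of the path lies one step of length \<open>m\<close> below the middle \<open>t\<close> of three consecutive
  integers at its top. Lengthening all three columns moves \<open>t\<close> to the end of the path.\<close>

lemma grow_triple:
  assumes std: "standard_linear_realization M p"
    and l: "{u, Suc u} \<in> links p" "{Suc u, Suc (Suc u)} \<in> links p"
    and n: "u + m = Suc (size M)" and last: "last p + m = Suc u" and m: "m \<ge> 2"
  obtains p' where "standard_linear_realization (M + {#m, m, m#}) p'"
    "{u + m, Suc (u + m)} \<in> links p'" "{Suc (u + m), Suc (Suc (u + m))} \<in> links p'"
    "last p' = Suc u" "\<And>e. e \<in> links p \<Longrightarrow> Suc u \<notin> e \<Longrightarrow> e \<in> links p'"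
proof -
  have len: "length p = u + m" using standard_length[OF std] n by simp
  have S: "distinct p" "set p = {..<u + m}" "lengths p = M" "hd p = 0"
    using std len by (auto simp: standard_iff)
  define t where "t = Suc u"
  obtain xs a b ys where p: "p = xs @ a # t # b # ys" and ab: "{a, b} = {u, Suc (Suc u)}"
    unfolding t_def by (rule two_linksE[OF S(1) l]) simp_all
  have ab': "a = u \<and> b = Suc t \<or> a = Suc t \<and> b = u"
    using ab unfolding t_def by (metis doubleton_eq_iff)
  \<comment> \<open>If \<open>b\<close> were the endpoint, \<open>m\<close> would be 1. So
    \<open>ys\<close> is not empty and contains the old endpoint.\<close>
  have b: "b \<noteq> last p" using last ab' m by (auto simp: t_def)
  then have ys: "ys \<noteq> []" by (auto simp: p)
  \<comment> \<open>The new edges of length \<open>m\<close> are \<open>a\<close> to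
    \<open>a + m\<close>, \<open>b + m\<close> to \<open>b\<close>, and the old endpoint to
    \<open>t\<close>; the two unit edges at \<open>t\<close> are moved up by
    \<open>m\<close>.\<close>
  define p' where "p' = xs @ a # (a + m) # (t + m) # (b + m) # b # ys @ [t]"
  have u: "u + m \<ge> Suc (Suc (Suc u))"
  proof -
    have "{u, Suc (Suc u)} \<subseteq> set p" using ab p by auto
    then show ?thesis using S by auto
  qed
  have "set p' = set p \<union> {a + m, t + m, b + m}" by (auto simp: p'_def p)
  also have "\<dots> = {..<u + m} \<union> {u + m, Suc u + m, Suc (Suc u) + m}"
    using S(2) ab' by (elim disjE) (auto simp: t_def)
  also have "\<dots> = {..<length p'}" using len by (auto simp: p'_def p)
  finally have set: "set p' = {..<length p'}" .
  have ge: "a + m \<notin> set p" "t + m \<notin> set p" "b + m \<notin> set p" "a \<noteq> b" "a \<noteq> t" "b \<noteq> t"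
    using ab' unfolding S(2) t_def by (elim disjE; simp)+
  then have d: "distinct p'" using S(1) unfolding p'_def p by auto
  have ll: "linear_length a t = 1" "linear_length t b = 1"
    using ab' unfolding t_def by auto
  have lm: "linear_length (c + m) (e + m) = linear_length c e" for c e
    by (simp add: linear_length_def)
  have "linear_length (last ys) t = m"
    using last ys by (simp add: p t_def linear_length_def)
  then have "lengths (b # ys @ [t]) = lengths (b # ys) + {#m#}" using lengths_append[of "b # ys" "[t]"] ys by simp
  then have "lengths p' = lengths p + {#m, m, m#}" using ll by (simp add: p'_def p lengths_split2 lm)
  moreover have "hd p' = hd p" "last p' = t" by (cases xs; simp add: p'_def p)+
  moreover have "{u + m, Suc (u + m)} \<in> links p'" "{Suc (u + m), Suc (Suc (u + m))} \<in> links p'"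
    using ab' by (auto simp: p'_def links_split2 t_def insert_commute)
  moreover have "e \<in> links p'" if "e \<in> links p" "Suc u \<notin> e" for e
    using that links_append_subset[of "b # ys" "[t]"]
    by (auto simp: p'_def p links_split2 t_def)
  ultimately show ?thesis using that[of p'] d set S by (auto simp: standard_iff p'_def t_def)
qed

section \<open>Gluing two standard paths, and adding ones\<close>

text \<open>Mirrored in [0, L] and reversed, \<open>p\<close> ends at \<open>L\<close>; shifted by
  \<open>L\<close>, \<open>q\<close> starts there. Both maps preserve lengths, and the common vertex
  is written only once, hence \<open>q'\<close> in the second piece.\<close>

lemma glue:
  assumes "standard_linear_realization M p" "standard_linear_realization N q"
  shows "\<exists>r. linear_realization (M + N) r"
proof -
  have P: "p \<noteq> []" "distinct p" "set p = {..<length p}" "lengths p = M" "hd p = 0"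
    and Q: "q \<noteq> []" "distinct q" "set q = {..<length q}" "lengths q = N" "hd q = 0"
    using assms by (simp_all add: standard_iff)
  obtain p' where p: "p = 0 # p'" using P by (cases p) auto
  obtain q' where q: "q = 0 # q'" using Q by (cases q) auto
  define L where "L = length p'"
  have lp: "length p = Suc L" by (simp add: p L_def)
  have le: "v \<le> L" if "v \<in> set p" for v using that P(3) lp by simp
  define r where "r = map (\<lambda>v. L - v) (rev p) @ map (\<lambda>v. v + L) q'"
  have "lengths r = lengths (map (\<lambda>v. L - v) (rev p)) + lengths (map (\<lambda>v. v + L) q)"
    using lengths_split[of "map (\<lambda>v. L - v) (rev p')" L "map (\<lambda>v. v + L) q'"]
    by (simp add: r_def p q)
  also have "lengths (map (\<lambda>v. L - v) (rev p)) = lengths (rev p)"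
    by (rule lengths_map) (auto simp: linear_length_def dest!: le)
  also have "lengths (map (\<lambda>v. v + L) q) = lengths q"
    by (rule lengths_map) (simp add: linear_length_def)
  finally have lengths: "lengths r = M + N" using P Q by (simp add: lengths_rev)
  have q': "set q' = {0<..<length q}"
  proof -
    have "set q' = set q - {0}" using Q(2) by (auto simp: q)
    also have "\<dots> = {0<..<length q}" by (subst Q(3)) auto
    finally show ?thesis .
  qed
  have s: "set (map (\<lambda>v. L - v) (rev p)) = {..L}"
  proof -
    have "set (map (\<lambda>v. L - v) (rev p)) = (\<lambda>v. L - v) ` {..L}" using P(3) lp by auto
    also have "\<dots> = {..L}"
    proof (intro equalityI subsetI)
      fix v assume "v \<in> {..L}"
      then show "v \<in> (\<lambda>v. L - v) ` {..L}" by (intro image_eqI[of _ _ "L - v"]) auto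
    qed auto
    finally show ?thesis .
  qed
  have s': "set (map (\<lambda>v. v + L) q') = {L<..<L + length q}"
  proof (intro equalityI subsetI)
    fix v assume "v \<in> {L<..<L + length q}"
    then show "v \<in> set (map (\<lambda>v. v + L) q')"
      unfolding set_map q' by (intro image_eqI[of _ _ "v - L"]) auto
  qed (auto simp: q')
  have "distinct (map (\<lambda>v. L - v) (rev p))"
    using P(2) by (auto simp: distinct_map inj_on_def dest!: le)
  moreover have "distinct (map (\<lambda>v. v + L) q')" using Q(2) by (auto simp: distinct_map q inj_on_def)
  ultimately have "distinct r" unfolding r_def distinct_append s s' by auto
  moreover have "set r = {..<length r}"
  proof -
    have "length r = L + length q" by (simp add: r_def lp q)
    moreover have "length q = Suc (length q')" by (simp add: q)
    ultimately show ?thesis unfolding r_def set_append s s' by auto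
  qed
  ultimately show ?thesis using lengths
    by (intro exI[of _ r]) (auto simp: linear_realization_iff r_def p)
qed

text \<open>Shifting a standard path by one and putting 0 in front adds just the edge from 0 to
  1.\<close>

lemma standard_prepend_ones:
  assumes "standard_linear_realization M p"
  shows "\<exists>p. standard_linear_realization (M + replicate_mset k 1) p"
proof (induction k)
  case 0
  then show ?case using assms by auto
next
  case (Suc k)
  then obtain q where q: "q \<noteq> []" "distinct q" "set q = {..<length q}" "hd q = 0"
    "lengths q = M + replicate_mset k 1" by (auto simp: standard_iff)
  have "lengths (map Suc q) = lengths q" by (rule lengths_map) (simp add: linear_length_def)
  then have "lengths (0 # map Suc q) = M + replicate_mset (Suc k) 1"
    using q lengths_append[of "[0]" "map Suc q"] by (simp add: hd_map)
  moreover have "set (0 # map Suc q) = {..<Suc (length q)}"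
    using q(3) by (simp add: lessThan_Suc_eq_insert_0)
  ultimately have "standard_linear_realization (M + replicate_mset (Suc k) 1) (0 # map Suc q)"
    using q(2) by (simp add: standard_iff distinct_map)
  then show ?case ..
qed

section \<open>Ladders: zigzags between two rails at distance \<open>x\<close>\<close>

text \<open>The path zigzags along \<open>k\<close> pairs of rungs \<open>{i, x + i}\<close>, \<open>i = e, e + 1, \<dots>\<close>, and then walks up
  to \<open>f - 1\<close>.\<close>

fun ladder :: "nat \<Rightarrow> nat \<Rightarrow> nat \<Rightarrow> nat \<Rightarrow> nat list" where
  "ladder x f e 0 = [e..<f]"
| "ladder x f e (Suc k) = e # (x + e) # Suc (x + e) # Suc e # ladder x f (Suc (Suc e)) k"

lemma ladder_hd:
  "e + 2 * k < f \<Longrightarrow> ladder x f e k \<noteq> [] \<and> hd (ladder x f e k) = e"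
  by (cases k) (auto simp: hd_upt)

lemma set_ladder:
  "e + 2 * k < f \<Longrightarrow> set (ladder x f e k) = {e..<f} \<union> {x + e..<x + e + 2 * k}"
  by (induction x f e k rule: ladder.induct) auto

text \<open>The bound on \<open>f\<close> keeps the lower rail below the upper one.\<close>

lemma distinct_ladder:
  "e + 2 * k < f \<Longrightarrow> f \<le> x + e \<Longrightarrow> distinct (ladder x f e k)"
proof (induction x f e k rule: ladder.induct)
  case (2 x f e k)
  then show ?case using set_ladder[of "Suc (Suc e)" k f x] by auto
qed simp

text \<open>Each round climbs one rung and descends the next, replacing the unit edge from
  \<open>e\<close> to \<open>Suc e\<close> by its translate on the upper rail. So the number of ones
  does not depend on \<open>k\<close>.\<close>

lemma lengths_ladder:
  "e + 2 * k < f \<Longrightarrow>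
    lengths (ladder x f e k) = replicate_mset (f - e - 1) 1 + replicate_mset (2 * k) x"
proof (induction x f e k rule: ladder.induct)
  case (1 x f e)
  then show ?case by (simp add: lengths_upt)
next
  case (2 x f e k)
  have "ladder x f (Suc (Suc e)) k \<noteq> []" "hd (ladder x f (Suc (Suc e)) k) = Suc (Suc e)"
    using 2 ladder_hd[of "Suc (Suc e)" k f x] by auto
  then obtain ys where ys: "ladder x f (Suc (Suc e)) k = Suc (Suc e) # ys"
    by (metis list.collapse)
  have "linear_length (Suc (x + e)) (Suc e) = x" "linear_length e (x + e) = x"
    by (auto simp: linear_length_def)
  moreover have "f - e - 1 = Suc (Suc (f - Suc (Suc e) - 1))" using 2 by simp
  ultimately show ?case using 2 ys by simp
qed

text \<open>The unit edges of a round start at \<open>x + e\<close> and at \<open>Suc e\<close>. As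
  \<open>x\<close> is odd, both have the parity opposite to \<open>e\<close>, which is unchanged
  from round to round.\<close>

lemma links_ladder:
  assumes "e + 2 * k < f" "odd x" "odd (i + e)" "e \<le> i"
    "Suc i < f \<or> x + e \<le> i \<and> Suc i < x + e + 2 * k"
  shows "{i, Suc i} \<in> links (ladder x f e k)"
  using assms
proof (induction x f e k rule: ladder.induct)
  case (1 x f e)
  then show ?case by (auto intro: links_upt)
next
  case (2 x f e k)
  have "ladder x f (Suc (Suc e)) k \<noteq> []" "hd (ladder x f (Suc (Suc e)) k) = Suc (Suc e)"
    using 2 ladder_hd[of "Suc (Suc e)" k f x] by auto
  then obtain ys where ys: "ladder x f (Suc (Suc e)) k = Suc (Suc e) # ys"
    by (metis list.collapse)
  show ?case
  proof (cases "i = Suc e \<or> i = x + e")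
    case True
    then show ?thesis using ys by auto
  next
    case False
    have "i \<noteq> e" using 2 by auto
    moreover have "i \<noteq> Suc (x + e)" using 2 by auto
    ultimately have "{i, Suc i} \<in> links (ladder x f (Suc (Suc e)) k)"
      using False 2 by (intro 2(1)) auto
    then show ?thesis using ys by simp
  qed
qed

text \<open>With \<open>f = x + e\<close> the lower rail stops exactly where the upper one begins,
  so together with the initial walk from 0 to \<open>e\<close> the vertices fill an
  interval.\<close>

lemma ladder_path:
  assumes x: "odd x" "2 * k < x"
  obtains p where "p \<noteq> []" "distinct p" "set p = {..<x + e + 2 * k}" "hd p = 0"
    "lengths p = replicate_mset (x + e - 1) 1 + replicate_mset (2 * k) x"
    "\<And>i. odd (i + e) \<Longrightarrow> Suc i < x + e + 2 * k \<Longrightarrow> {i, Suc i} \<in> links p"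
proof -
  let ?T = "ladder x (x + e) e k"
  have k: "e + 2 * k < x + e" using x by simp
  have T: "?T \<noteq> []" "hd ?T = e" using ladder_hd[OF k] by auto
  define p where "p = [0..<e] @ ?T"
  have "set p = {..<x + e + 2 * k}" using set_ladder[OF k] by (auto simp: p_def)
  moreover have "distinct p" using set_ladder[OF k] distinct_ladder[OF k] by (auto simp: p_def)
  moreover have "hd p = 0" using T by (cases "e = 0") (auto simp: p_def hd_append)
  moreover have "lengths p = replicate_mset (x + e - 1) 1 + replicate_mset (2 * k) x"
  proof (cases e)
    case 0
    then show ?thesis using lengths_ladder[OF k, of x] by (simp add: p_def)
  next
    case (Suc f)
    have "lengths p = replicate_mset (Suc f - 1) 1 +
        add_mset 1 (replicate_mset (x - 1) 1 + replicate_mset (2 * k) x)"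
      using lengths_append[of "[0..<e]" ?T] T lengths_ladder[OF k, of x] Suc lengths_upt[of 0 "Suc f"]
      by (simp add: p_def)
    moreover have "x + e - 1 = (Suc f - 1) + 1 + (x - 1)" using x Suc by simp
    ultimately show ?thesis by (simp only: replicate_mset_add) simp
  qed
  moreover have "{i, Suc i} \<in> links p" if i: "odd (i + e)" "Suc i < x + e + 2 * k" for i
  proof -
    consider "Suc i < e" | "Suc i = e" | "e \<le> i" by linarith
    then show ?thesis
    proof cases
      case 1
      then show ?thesis using links_append_subset[of "[0..<e]" ?T] links_upt[of 0 i e]
        by (auto simp: p_def)
    next
      case 2
      then show ?thesis using links_join[of "[0..<e]" ?T] T by (auto simp: p_def)
    next
      case 3
      \<comment> \<open>The pair straddling the two rails has the wrong parity, so no link is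
        required there.\<close>
      have "Suc i \<noteq> x + e"
      proof
        assume "Suc i = x + e"
        then have "Suc (i + e) = x + 2 * e" by simp
        then show False using i(1) x(1) by (metis even_Suc even_add even_mult_iff even_numeral)
      qed
      then have "{i, Suc i} \<in> links ?T" using 3 i x by (intro links_ladder) auto
      then show ?thesis using links_append_subset[of "[0..<e]" ?T] by (auto simp: p_def)
    qed
  qed
  ultimately show ?thesis using that[of p] T by (simp add: p_def)
qed

section \<open>The first claim: standard paths with lengths 1, \<open>x\<close> and
  \<open>y\<close>\<close>

text \<open>There are \<open>y + c\<close> vertices, and the links match the top \<open>y\<close> of
  them in consecutive pairs. Lifting the lowest pair by \<open>y\<close> makes it the highest, which
  restores the matching for \<open>c + 2\<close>; hence the induction with two base cases.\<close>

lemma standard_even_odd_with_links: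
  assumes y: "even y" and x: "odd x" "y div 2 \<le> x" "x < y - 1"
    and d: "even d" "d \<le> y - x - 1"
  shows "\<exists>p. standard_linear_realization
      (replicate_mset (y - 1 - d) 1 + replicate_mset d x + replicate_mset c y) p \<and>
    (\<forall>j<y div 2. {c + 2 * j, Suc (c + 2 * j)} \<in> links p)"
proof (induction c rule: induct_nat_012)
  case 0
  obtain k where k: "d = 2 * k" using d by blast
  \<comment> \<open>The ladder has to fill [0, y). Then \<open>e\<close> is odd, so its links start
    at even numbers and match all of [0, y).\<close>
  define e where "e = y - x - d"
  have e: "x + e + 2 * k = y" "odd e" "x + e - 1 = y - 1 - d" "2 * k < x"
    using k d x y by (auto simp: e_def)
  obtain p where p: "p \<noteq> []" "distinct p" "set p = {..<y}" "hd p = 0"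
    "lengths p = replicate_mset (y - 1 - d) 1 + replicate_mset d x"
    "\<And>i. odd (i + e) \<Longrightarrow> Suc i < y \<Longrightarrow> {i, Suc i} \<in> links p"
    using ladder_path[OF x(1) e(4), of e] unfolding e(1) e(3) k by metis
  have "standard_linear_realization
      (replicate_mset (y - 1 - d) 1 + replicate_mset d x + replicate_mset 0 y) p"
    using p by (intro standardI) auto
  moreover have "{0 + 2 * j, Suc (0 + 2 * j)} \<in> links p" if "j < y div 2" for j
    using that e(2) y by (intro p(6)) auto
  ultimately show ?case by blast
next
  case 1
  \<comment> \<open>The reflection \<open>r \<mapsto> y - 1 - r\<close> shifts the parity of the matching, as needed for odd \<open>c\<close>.\<close>
  obtain k where k: "d = 2 * k" using d by blast
  \<comment> \<open>The ladder has to fill only [0, y - 1). Its mirror image covers 1 to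
    \<open>y - 1\<close> starting from the top, preceded by the edge from 0 to \<open>y\<close> and
    the unit edge from \<open>y\<close> to \<open>y - 1\<close>.\<close>
  define e where "e = y - x - 1 - d"
  have e: "x + e + 2 * k = y - 1" "even e" "x + e - 1 = y - 2 - d" "2 * k < x"
    using k d x y by (auto simp: e_def)
  obtain p where p: "p \<noteq> []" "distinct p" "set p = {..<y - 1}" "hd p = 0"
    "lengths p = replicate_mset (y - 2 - d) 1 + replicate_mset d x"
    "\<And>i. odd (i + e) \<Longrightarrow> Suc i < y - 1 \<Longrightarrow> {i, Suc i} \<in> links p"
    using ladder_path[OF x(1) e(4), of e] unfolding e(1) e(3) k by metis
  define f where "f = (\<lambda>r. y - 1 - r)"
  have "lengths (map f p) = lengths p"
    by (rule lengths_map) (auto simp: p(3) f_def linear_length_def)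
  obtain p' where p': "p = 0 # p'" using p by (cases p) auto
  have "linear_length y (y - 1) = 1" using x by (simp add: linear_length_def)
  moreover have "y - 1 - d = Suc (y - 2 - d)" using d x by auto
  ultimately have lengths: "lengths (0 # y # map f p) =
      replicate_mset (y - 1 - d) 1 + replicate_mset d x + replicate_mset 1 y"
    using p(5) \<open>lengths (map f p) = lengths p\<close> by (simp add: p' f_def)
  have s: "set (map f p) = {0<..<y}"
  proof (intro equalityI subsetI)
    fix v assume "v \<in> {0<..<y}"
    then have "v = f (y - 1 - v)" "y - 1 - v \<in> set p" unfolding p(3) by (auto simp: f_def)
    then show "v \<in> set (map f p)" by (metis image_eqI set_map)
  qed (auto simp: p(3) f_def)
  have "distinct (map f p)"
    using p(2) unfolding distinct_map by (auto simp: p(3) f_def inj_on_def)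
  then have "distinct (0 # y # map f p)" using x unfolding distinct.simps list.set s by auto
  moreover have "set (0 # y # map f p) = {..<Suc y}" unfolding list.set(2) s by auto
  ultimately have "standard_linear_realization
      (replicate_mset (y - 1 - d) 1 + replicate_mset d x + replicate_mset 1 y) (0 # y # map f p)"
    using lengths by (intro standardI[where n = "Suc y"]) simp_all
  moreover have "{1 + 2 * j, Suc (1 + 2 * j)} \<in> links (0 # y # map f p)" if j: "j < y div 2" for j
  \<comment> \<open>The highest pair joins \<open>y\<close> to the mirrored ladder; the other pairs
    are mirrored ladder links.\<close>
  proof (cases "Suc j = y div 2")
    case True
    then have "{1 + 2 * j, Suc (1 + 2 * j)} = {y, f 0}" using y by (auto simp: f_def)
    then show ?thesis by (simp add: p')
  next
    case False
    define i where "i = y - 3 - 2 * j"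
    have i: "odd (i + e)" "Suc i < y - 1" "1 + 2 * j = f (Suc i)" "Suc (1 + 2 * j) = f i"
      using j False y e(2) by (auto simp: i_def f_def)
    have "f ` {i, Suc i} \<in> links (map f p)" unfolding links_map using p(6)[OF i(1,2)] by blast
    moreover have "{1 + 2 * j, Suc (1 + 2 * j)} = f ` {i, Suc i}" using i(3,4) by auto
    ultimately have "{1 + 2 * j, Suc (1 + 2 * j)} \<in> links (map f p)" by simp
    then show ?thesis by (simp add: p')
  qed
  ultimately show ?case unfolding One_nat_def by blast
next
  case (ge2 c)
  then obtain p where p: "standard_linear_realization
      (replicate_mset (y - 1 - d) 1 + replicate_mset d x + replicate_mset c y) p"
    "\<And>j. j < y div 2 \<Longrightarrow> {c + 2 * j, Suc (c + 2 * j)} \<in> links p" by blast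
  have h: "{c, Suc c} \<in> links p" using p(2)[of 0] x by simp
  have n: "c + y = Suc (size (replicate_mset (y - 1 - d) 1 + replicate_mset d x + replicate_mset c y))"
    using d x by simp
  obtain p' where p': "standard_linear_realization
      (replicate_mset (y - 1 - d) 1 + replicate_mset d x + replicate_mset c y + {#y, y#}) p'"
    "{c + y, Suc (c + y)} \<in> links p'" "links p - {{c, Suc c}} \<subseteq> links p'"
    using grow_pair[OF p(1) h n] by metis
  have "{Suc (Suc c) + 2 * j, Suc (Suc (Suc c) + 2 * j)} \<in> links p'" if j: "j < y div 2" for j
  \<comment> \<open>Pair \<open>j\<close> for \<open>c + 2\<close> is pair \<open>j + 1\<close> for
    \<open>c\<close>, except that the last one has just been created.\<close>
  proof (cases "Suc j = y div 2")
    case True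
    then have "Suc (Suc c) + 2 * j = c + y" using y by auto
    then show ?thesis using p'(2) by (simp only:)
  next
    case False
    then have "{c + 2 * Suc j, Suc (c + 2 * Suc j)} \<in> links p" using j by (intro p(2)) auto
    moreover have "{c + 2 * Suc j, Suc (c + 2 * Suc j)} \<noteq> {c, Suc c}"
      by (auto simp: doubleton_eq_iff)
    ultimately show ?thesis using p'(3) by auto
  qed
  then show ?case using p'(1) by (intro exI[of _ p']) auto
qed

section \<open>Standard paths with \<open>x\<close> ones and any number of lengths
  \<open>x\<close>\<close>

lemma lengths_rev_upt: "lengths (rev [i..<j]) = replicate_mset (j - i - 1) 1"
  by (simp only: lengths_rev lengths_upt)

text \<open>Of the top \<open>x\<close> vertices the lowest, \<open>2 + q * x\<close>, is the end of
  the path, and the other \<open>2 * h\<close> are matched. Extending the end and then lifting every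
  pair moves this configuration up by \<open>x\<close>, at the cost of \<open>x\<close> edges of
  length \<open>x\<close>.\<close>

lemma standard_residue_one_with_links:
  assumes x: "x = 2 * h + 1" "h \<ge> 1"
  shows "\<exists>p. standard_linear_realization (replicate_mset x 1 + replicate_mset (1 + q * x) x) p \<and>
    last p = 2 + q * x \<and> (\<forall>j<h. {3 + q * x + 2 * j, Suc (3 + q * x + 2 * j)} \<in> links p)"
proof (induction q)
  case 0
  \<comment> \<open>The path is 0, 1, x + 1, x, ..., 2; its only edge of length \<open>x\<close>
    leads from 1 to \<open>x + 1\<close>.\<close>
  define p where "p = [0, 1] @ rev [2..<x + 2]"
  have r: "rev [2..<x + 2] \<noteq> []" "hd (rev [2..<x + 2]) = 1 + x" "last (rev [2..<x + 2]) = 2"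
    using x by (auto simp: hd_rev last_rev)
  have "lengths p = lengths [0, 1] + add_mset x (lengths (rev [2..<x + 2]))"
    unfolding p_def by (subst lengths_append) (use r in \<open>simp_all add: linear_length_def del: upt_Suc\<close>)
  also have "\<dots> = replicate_mset (Suc (x - 1)) 1 + replicate_mset (1 + 0 * x) x"
    unfolding lengths_rev_upt by simp
  finally have "standard_linear_realization (replicate_mset x 1 + replicate_mset (1 + 0 * x) x) p"
    using x by (intro standardI[where n = "x + 2"]) (auto simp: p_def)
  moreover have "last p = 2 + 0 * x" unfolding p_def using r by (simp del: upt_Suc)
  moreover have "{3 + 0 * x + 2 * j, Suc (3 + 0 * x + 2 * j)} \<in> links p" if "j < h" for j
  proof -
    have "{3 + 2 * j, Suc (3 + 2 * j)} \<in> links (rev [2..<x + 2])"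
      unfolding links_rev using that x by (intro links_upt) auto
    then have "{3 + 2 * j, Suc (3 + 2 * j)} \<in> links p"
      using links_append_subset[of "[0, 1]" "rev [2..<x + 2]"] unfolding p_def by blast
    then show ?thesis by simp
  qed
  ultimately show ?case by blast
next
  case (Suc q)
  then obtain p where p: "standard_linear_realization
      (replicate_mset x 1 + replicate_mset (1 + q * x) x) p" "last p = 2 + q * x"
    "\<And>j. j < h \<Longrightarrow> {3 + q * x + 2 * j, Suc (3 + q * x + 2 * j)} \<in> links p" by blast
  let ?p = "p @ [last p + x]"
  let ?M = "add_mset x (replicate_mset x 1 + replicate_mset (1 + q * x) x)"
  have std: "standard_linear_realization ?M ?p"
    by (rule grow_last[OF p(1)]) (simp add: p(2))
  have l: "{3 + q * x + 2 * j, Suc (3 + q * x + 2 * j)} \<in> links ?p" if "j < h" for j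
    using p(3)[OF that] links_append_subset[of p "[last p + x]"] by blast
  have n: "3 + q * x + x = Suc (size ?M)" by simp
  have h: "2 * h \<le> x" using x by simp
  obtain p' where p': "standard_linear_realization (?M + replicate_mset (2 * h) x) p'"
    "\<forall>j<h. {3 + q * x + x + 2 * j, Suc (3 + q * x + x + 2 * j)} \<in> links p'" "last p' = last ?p"
    using grow_pairs[OF std n h l] by blast
  have "1 + Suc q * x = Suc ((1 + q * x) + 2 * h)" using x by simp
  then have M: "?M + replicate_mset (2 * h) x = replicate_mset x 1 + replicate_mset (1 + Suc q * x) x"
    by (simp only: replicate_mset_add replicate_mset_Suc) simp
  have "last p' = 2 + Suc q * x" using p'(3) p(2) by simp
  moreover have "{3 + Suc q * x + 2 * j, Suc (3 + Suc q * x + 2 * j)} \<in> links p'" if "j < h" for j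
  proof -
    have "3 + Suc q * x = 3 + q * x + x" by simp
    then show ?thesis using p'(2) that by presburger
  qed
  ultimately show ?case using p'(1) unfolding M by blast
qed

text \<open>The round from \<open>q\<close> to \<open>q + 1\<close> is broken off after the end has
  been extended and \<open>k\<close> pairs have been lifted.\<close>

lemma standard_residue_even:
  assumes x: "x = 2 * h + 1" "h \<ge> 1" and k: "k \<le> h"
  shows "\<exists>p. standard_linear_realization (replicate_mset x 1 + replicate_mset (2 + q * x + 2 * k) x) p"
proof -
  obtain p where p: "standard_linear_realization
      (replicate_mset x 1 + replicate_mset (1 + q * x) x) p" "last p = 2 + q * x"
    "\<And>j. j < h \<Longrightarrow> {3 + q * x + 2 * j, Suc (3 + q * x + 2 * j)} \<in> links p"
    using standard_residue_one_with_links[OF x, of q] by blast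
  let ?p = "p @ [last p + x]"
  let ?M = "add_mset x (replicate_mset x 1 + replicate_mset (1 + q * x) x)"
  have std: "standard_linear_realization ?M ?p"
    by (rule grow_last[OF p(1)]) (simp add: p(2))
  have l: "{3 + q * x + 2 * j, Suc (3 + q * x + 2 * j)} \<in> links ?p" if "j < k" for j
    using p(3)[of j] that k links_append_subset[of p "[last p + x]"] by auto
  have n: "3 + q * x + x = Suc (size ?M)" by simp
  have h: "2 * k \<le> x" using x k by simp
  have "\<exists>p'. standard_linear_realization (?M + replicate_mset (2 * k) x) p'"
    using grow_pairs[OF std n h l] by blast
  moreover have "2 + q * x + 2 * k = Suc ((1 + q * x) + 2 * k)" by simp
  ultimately show ?thesis by (simp add: replicate_mset_add add.assoc)
qed

text \<open>The top \<open>x\<close> vertices consist of \<open>g\<close> pairs and, above them, a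
  run of three whose middle lies \<open>x\<close> above the end of the path. Lifting first the pairs
  and then the run by \<open>grow_triple\<close> moves this configuration up by
  \<open>x\<close>.\<close>

lemma standard_residue_three_with_links:
  assumes x: "x = 2 * g + 3"
  shows "\<exists>p. standard_linear_realization (replicate_mset x 1 + replicate_mset (3 + q * x) x) p \<and>
    last p = 2 + q * x \<and> (\<forall>j<g. {4 + q * x + 2 * j, Suc (4 + q * x + 2 * j)} \<in> links p) \<and>
    {x + 1 + q * x, Suc (x + 1 + q * x)} \<in> links p \<and>
    {Suc (x + 1 + q * x), Suc (Suc (x + 1 + q * x))} \<in> links p"
proof (induction q)
  case 0
  \<comment> \<open>The path is 0, x, x - 1, ..., 3, x + 3, x + 2, x + 1, 1, 2. The run of three is
    at its top, and the end 2 lies \<open>x\<close> below the middle of the run.\<close>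
  define z where "z = [x + 3, x + 2, x + 1, 1, 2]"
  define p where "p = [0] @ rev [3..<x + 1] @ z"
  have r: "rev [3..<x + 1] \<noteq> []" "hd (rev [3..<x + 1]) = x" "last (rev [3..<x + 1]) = 3"
    using x by (auto simp: hd_rev last_rev)
  have z: "z \<noteq> []" "hd z = 3 + x" by (auto simp: z_def)
  have "lengths z = {#1, 1, x, 1#}" by (simp add: z_def linear_length_def)
  then have "lengths p = add_mset x (lengths (rev [3..<x + 1]) + add_mset x {#1, 1, x, 1#})"
    unfolding p_def using r z by (subst lengths_append; simp add: lengths_append del: upt_Suc)+
  also have "\<dots> = replicate_mset (2 * g + 3) 1 + replicate_mset (3 + 0 * x) x"
    unfolding lengths_rev_upt x by (simp add: numeral_3_eq_3)
  finally have "standard_linear_realization (replicate_mset x 1 + replicate_mset (3 + 0 * x) x) p"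
    unfolding x[symmetric] by (intro standardI[where n = "x + 4"]) (auto simp: p_def z_def x)
  moreover have "last p = 2 + 0 * x" by (simp add: p_def z_def)
  moreover have "links (rev [3..<x + 1]) \<union> links z \<subseteq> links p"
    using links_append_subset[of "[0]" "rev [3..<x + 1] @ z"]
      links_append_subset[of "rev [3..<x + 1]" z] unfolding p_def by blast
  moreover have "{4 + 0 * x + 2 * j, Suc (4 + 0 * x + 2 * j)} \<in> links (rev [3..<x + 1])"
    if "j < g" for j
    using that x links_upt[of 3 "4 + 2 * j" "x + 1"] unfolding links_rev by auto
  moreover have "{x + 1 + 0 * x, Suc (x + 1 + 0 * x)} \<in> links z"
    "{Suc (x + 1 + 0 * x), Suc (Suc (x + 1 + 0 * x))} \<in> links z"
    by (auto simp: z_def insert_commute)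
  ultimately show ?case by (intro exI[of _ p]) blast
next
  case (Suc q)
  then obtain p where p: "standard_linear_realization
      (replicate_mset x 1 + replicate_mset (3 + q * x) x) p" "last p = 2 + q * x"
    "\<And>j. j < g \<Longrightarrow> {4 + q * x + 2 * j, Suc (4 + q * x + 2 * j)} \<in> links p"
    "{x + 1 + q * x, Suc (x + 1 + q * x)} \<in> links p"
    "{Suc (x + 1 + q * x), Suc (Suc (x + 1 + q * x))} \<in> links p" by blast
  let ?M = "replicate_mset x 1 + replicate_mset (3 + q * x) x + replicate_mset (2 * g) x"
  obtain p1 where p1: "standard_linear_realization ?M p1"
    "\<And>j. j < g \<Longrightarrow> {4 + q * x + x + 2 * j, Suc (4 + q * x + x + 2 * j)} \<in> links p1"
    "last p1 = last p"
    "\<And>e. e \<in> links p \<Longrightarrow> e \<inter> {4 + q * x..<4 + q * x + 2 * g} = {} \<Longrightarrow> e \<in> links p1"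
    using grow_pairs[OF p(1), of "4 + q * x" x g] p(3) x by auto
  let ?u = "x + 1 + q * x"
  \<comment> \<open>The run starts at \<open>4 + q * x + 2 * g\<close>, just above the pairs, so
    lifting these has not touched it.\<close>
  have l: "{?u, Suc ?u} \<in> links p1" "{Suc ?u, Suc (Suc ?u)} \<in> links p1"
    using p(4,5) x by (auto intro!: p1(4))
  obtain p2 where p2: "standard_linear_realization (?M + {#x, x, x#}) p2"
    "{?u + x, Suc (?u + x)} \<in> links p2" "{Suc (?u + x), Suc (Suc (?u + x))} \<in> links p2"
    "last p2 = Suc ?u" "\<And>e. e \<in> links p1 \<Longrightarrow> Suc ?u \<notin> e \<Longrightarrow> e \<in> links p2"
    by (rule grow_triple[OF p1(1) l, of x]) (use p1(3) p(2) x in simp_all)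
  \<comment> \<open>The lifted pairs lie above \<open>Suc ?u\<close>, the only vertex whose links
    the triple step may destroy.\<close>
  have "{4 + Suc q * x + 2 * j, Suc (4 + Suc q * x + 2 * j)} \<in> links p2" if "j < g" for j
    using p2(5)[OF p1(2)[OF that]] by (simp add: ac_simps)
  moreover have "?M + {#x, x, x#} = replicate_mset x 1 + replicate_mset (3 + Suc q * x) x"
  proof -
    have "3 + Suc q * x = Suc (Suc (Suc ((3 + q * x) + 2 * g)))" using x by simp
    then show ?thesis by (simp only: replicate_mset_add replicate_mset_Suc) simp
  qed
  moreover have "?u + x = x + 1 + Suc q * x" "Suc ?u = 2 + Suc q * x" by simp_all
  ultimately show ?case using p2(1-4) by (intro exI[of _ p2]) metis
qed

text \<open>Here the round is broken off after \<open>k\<close> pairs, before the run of three is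
  reached.\<close>

lemma standard_residue_odd:
  assumes x: "x = 2 * g + 3" and k: "k \<le> g"
  shows "\<exists>p. standard_linear_realization (replicate_mset x 1 + replicate_mset (3 + q * x + 2 * k) x) p"
proof -
  obtain p where p: "standard_linear_realization
      (replicate_mset x 1 + replicate_mset (3 + q * x) x) p"
    "\<And>j. j < g \<Longrightarrow> {4 + q * x + 2 * j, Suc (4 + q * x + 2 * j)} \<in> links p"
    using standard_residue_three_with_links[OF x, of q] by blast
  then have "\<exists>p'. standard_linear_realization
      (replicate_mset x 1 + replicate_mset (3 + q * x) x + replicate_mset (2 * k) x) p'"
    using grow_pairs[OF p(1), of "4 + q * x" x k] x k by auto
  then show ?thesis by (simp only: replicate_mset_add add.assoc)
qed

lemma standard_one_odd:
  assumes x: "odd x" "x \<ge> 3"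
  shows "\<exists>p. standard_linear_realization (replicate_mset x 1 + replicate_mset b x) p"
proof -
  define h where "h = (x - 1) div 2"
  have h: "x = 2 * h + 1" "h \<ge> 1" using x by (auto simp: h_def)
  define g where "g = h - 1"
  have g: "x = 2 * g + 3" "h = Suc g" using h by (auto simp: g_def)
  define q r where "q = b div x" and "r = b mod x"
  have b: "b = q * x + r" "r < x" using x by (auto simp: q_def r_def)
  consider "b = 0" | "r = 0" "q > 0" | "r = 1" | "even r" "r \<ge> 2" | "odd r" "r \<ge> 3"
  proof -
    have "r = 0 \<or> r = 1 \<or> even r \<and> r \<ge> 2 \<or> odd r \<and> r \<ge> 3" by (cases "even r") presburger+
    then show ?thesis using that b by fastforce
  qed
  then show ?thesis
  proof cases
    case 1
    have "standard_linear_realization (replicate_mset x 1) [0..<Suc x]"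
      unfolding standard_iff lengths_upt by (simp del: upt_Suc add: atLeast0LessThan)
    then show ?thesis using 1 by auto
  next
    case 2
    \<comment> \<open>A positive multiple of \<open>x\<close> counts as residue
      \<open>x = 3 + 2 * g\<close> with the quotient lowered by one.\<close>
    then obtain q' where "q = Suc q'" by (cases q) auto
    then have "b = 3 + q' * x + 2 * g" using b 2 g by simp
    then show ?thesis using standard_residue_odd[OF g(1), of g q'] by simp
  next
    case 3
    then show ?thesis using standard_residue_one_with_links[OF h, of q] b by (auto simp: ac_simps)
  next
    case 4
    then obtain m where m: "r = 2 * m" by blast
    then obtain k where "m = Suc k" using 4 by (cases m) auto
    then have "b = 2 + q * x + 2 * k" "k \<le> h" using b h m by auto
    then show ?thesis using standard_residue_even[OF h, of k q] by blast
  next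
    case 5
    then obtain m where m: "r = 2 * m + 1" by (elim oddE)
    then obtain k where "m = Suc k" using 5 by (cases m) auto
    then have "b = 3 + q * x + 2 * k" "k \<le> g" using b g m by auto
    then show ?thesis using standard_residue_odd[OF g(1), of k q] by blast
  qed
qed

section \<open>Both claims\<close>

theorem theorem3p7:
  fixes x y :: nat
  assumes "even y" and "odd x" and "y div 2 \<le> x" and "x < y - 1"
  shows "(\<forall>d c :: nat. even d \<and> d \<le> y - x - 1 \<longrightarrow>
            (\<exists>p. standard_linear_realization
                   (replicate_mset (y - 1 - d) 1 + replicate_mset d x + replicate_mset c y) p))
       \<and> (\<forall>a b c :: nat. a \<ge> 2 * x \<and> b \<ge> y - x - 1 \<longrightarrow>
            (\<exists>p. linear_realization
                   (replicate_mset a 1 + replicate_mset b x + replicate_mset c y) p))"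
proof (intro conjI allI impI)
  fix d c :: nat
  assume "even d \<and> d \<le> y - x - 1"
  then have d: "even d" "d \<le> y - x - 1" by simp_all
  from standard_even_odd_with_links[OF assms d, of c]
  show "\<exists>p. standard_linear_realization
      (replicate_mset (y - 1 - d) 1 + replicate_mset d x + replicate_mset c y) p"
    by (elim exE conjE) (rule exI)
next
  fix a b c :: nat
  assume ab: "2 * x \<le> a \<and> y - x - 1 \<le> b"
  define d where "d = y - x - 1"
  have y: "y = x + 1 + d" using assms(4) unfolding d_def by linarith
  have d: "even d" "d \<le> y - x - 1" "y - 1 - d = x"
    using assms(1,2) unfolding y by simp_all
  \<comment> \<open>For \<open>x = 1\<close> the bounds would give \<open>y \<le> 2\<close>,
    contradicting \<open>x < y - 1\<close>.\<close>
  have "x \<noteq> 1"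
    using assms(1,3,4) by presburger
  then have x: "x \<ge> 3" using assms(2) by presburger
  obtain p where p: "standard_linear_realization
      (replicate_mset x 1 + replicate_mset d x + replicate_mset c y) p"
    using standard_even_odd_with_links[OF assms d(1,2), of c] unfolding d(3) by (elim exE conjE)
  \<comment> \<open>Each of the two glued paths takes \<open>x\<close> of the ones; the surplus
    \<open>a'\<close> is put in front of the second.\<close>
  obtain a' where a: "a = x + x + a'" using ab by (metis le_add_diff_inverse mult_2)
  obtain b' where b: "b = d + b'" using ab unfolding d_def by (metis le_add_diff_inverse)
  obtain q where "standard_linear_realization (replicate_mset x 1 + replicate_mset b' x) q"
    using standard_one_odd[OF assms(2) x] by blast
  then obtain q' where q': "standard_linear_realization
      (replicate_mset x 1 + replicate_mset b' x + replicate_mset a' 1) q'"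
    using standard_prepend_ones by blast
  have "replicate_mset a 1 + replicate_mset b x + replicate_mset c y =
      (replicate_mset x 1 + replicate_mset d x + replicate_mset c y) +
      (replicate_mset x 1 + replicate_mset b' x + replicate_mset a' 1)"
    unfolding a b replicate_mset_add by (simp only: ac_simps)
  then show "\<exists>p. linear_realization (replicate_mset a 1 + replicate_mset b x + replicate_mset c y) p"
    using glue[OF p q'] by (simp only:)
qed

end
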